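(* Let $0<p<1$ and $h_N=\lceil Np\rceil-Np$ for $N\ge1$. Let $c_n(t;p)$ and $\gamma_{n,j}(r;p)$ be the coefficients defined in the context. (i) If $p$ is irrational, then $(h_N)_{N\ge1}$ is equidistributed in $[0,1)$ and, for every $n\ge0$ and every fixed $r\in\mathbb Z$, $$\lim_{M\to\infty}\frac1M\sum_{N=1}^{M}c_n(h_N+r;p)=\gamma_{n,0}(r;p)=\int_0^1c_n(h+r;p)\,dh.$$ (ii) If $p=a/b$ with integers $a,b$ satisfying $\gcd(a,b)=1$, then $h_N$ is periodic in $N$ with period $b$ and takes each of the values $0,\tfrac1b,\dots,\tfrac{b-1}b$ exactly once per period. For every $n\ge0$ and $r\in\mathbb Z$, the mean of $c_n$ over a period is obtained from the Bernoulli-basis expansion $c_n(h+r;p)=\sum_{j=0}^{2n}\gamma_{n,j}(r;p)B_j(h)$ by the substitution $B_j(h)\mapsto b^{-j}B_j$ for all $j\ge0$; that is, $$\frac1b\sum_{N=1}^{b}c_n(h_N+r;p)=\sum_{j=0}^{2n}\gamma_{n,j}(r;p)\,b^{-j}B_j,$$ where $B_j=B_j(0)$, so that in particular $B_1=-\tfrac12$.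
   Context: $B_n(t)$ are the Bernoulli polynomials, $\sum_{n\ge0}B_n(t)z^n/n!=\frac{z}{e^z-1}e^{tz}$, and $B_n=B_n(0)$. With $q=1-p$ and $k\ge1$, put $$A_k(t;p)=\frac{(-1)^{k+1}}{k(k+1)}\Bigl[B_{k+1}-\bigl(p^{-k}+(-1)^{k+1}q^{-k}\bigr)B_{k+1}(t)\Bigr]+\frac{(-1)^kt^k}{k\,p^k}.$$ The $c_n(t;p)$ are the exponential polynomials in $A_1,\dots,A_n$ given by the formal identity $\exp\bigl(\sum_{k\ge1}A_k(t;p)x^k\bigr)=\sum_{n\ge0}c_n(t;p)x^n$, so $c_0=1$ (they are the coefficients in the asymptotic expansion $\sqrt{2\pi Npq}\,\Pr\{X=\lceil Np\rceil+r\}\sim\sum_{n\ge0}c_n(h_N+r;p)N^{-n}$ for $X\sim\mathrm{Bin}(N,p)$). For fixed $r\in\mathbb Z$, $c_n(h+r;p)$ is a polynomial in $h$ of degree $2n$, and $\gamma_{n,j}(r;p)$, $0\le j\le 2n$, denote the unique coefficients in $c_n(h+r;p)=\sum_{j=0}^{2n}\gamma_{n,j}(r;p)B_j(h)$. *)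

theory Defs
  imports "HOL-Analysis.Analysis" "HOL-Computational_Algebra.Polynomial"
    "HOL-Computational_Algebra.Formal_Power_Series"
begin

definition bernpoly :: "nat \<Rightarrow> real \<Rightarrow> real" where
  "bernpoly n t = fact n * fps_nth (fps_X / (fps_exp 1 - 1) * fps_exp t) n"

definition bernoulli :: "nat \<Rightarrow> real" where
  "bernoulli n = bernpoly n 0"

text \<open>Only used for \<open>k \<ge> 1\<close>.\<close>

definition A_coeff :: "nat \<Rightarrow> real \<Rightarrow> real \<Rightarrow> real" where
  "A_coeff k t p =
     (-1) ^ (k + 1) / (real k * real (k + 1)) *
       (bernoulli (k + 1)
        - (1 / p ^ k + (-1) ^ (k + 1) * (1 / (1 - p) ^ k)) * bernpoly (k + 1) t)
     + (-1) ^ k * t ^ k / (real k * p ^ k)"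

definition A_series :: "real \<Rightarrow> real \<Rightarrow> real fps" where
  "A_series t p = Abs_fps (\<lambda>k. if k = 0 then 0 else A_coeff k t p)"

definition c_coeff :: "nat \<Rightarrow> real \<Rightarrow> real \<Rightarrow> real" where
  "c_coeff n t p = fps_nth (fps_exp 1 oo A_series t p) n"

text \<open>
  The coefficient family is extended by \<open>0\<close> beyond index \<open>2 * n\<close> so that it is a unique
  object of type \<^typ>\<open>nat \<Rightarrow> real\<close>; existence and uniqueness are proved
  in \<open>gamma_coeff_unique\<close> below.
\<close>

definition is_bernoulli_expansion :: "nat \<Rightarrow> int \<Rightarrow> real \<Rightarrow> (nat \<Rightarrow> real) \<Rightarrow> bool" where
  "is_bernoulli_expansion n r p g \<longleftrightarrow>
     (\<forall>j > 2 * n. g j = 0) \<and>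
     (\<forall>h. c_coeff n (h + of_int r) p = (\<Sum>j\<le>2 * n. g j * bernpoly j h))"

definition gamma_coeff :: "nat \<Rightarrow> nat \<Rightarrow> int \<Rightarrow> real \<Rightarrow> real" where
  "gamma_coeff n j r p = (THE g. is_bernoulli_expansion n r p g) j"

definition h_seq :: "real \<Rightarrow> nat \<Rightarrow> real" where
  "h_seq p N = of_int \<lceil>real N * p\<rceil> - real N * p"

text \<open>Sequences are indexed from \<open>1\<close>; the value at \<open>0\<close> plays no role.\<close>

definition equidistributed_01 :: "(nat \<Rightarrow> real) \<Rightarrow> bool" where
  "equidistributed_01 x \<longleftrightarrow>
     (\<forall>N\<ge>1. x N \<in> {0..<1}) \<and>
     (\<forall>u v. 0 \<le> u \<and> u < v \<and> v \<le> 1 \<longrightarrow>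
        (\<lambda>M. real (card {N \<in> {1..M}. x N \<in> {u..<v}}) / real M) \<longlonglongrightarrow> v - u)"


subsection \<open>Existence and uniqueness of the Bernoulli-basis expansion\<close>

definition is_poly_deg :: "nat \<Rightarrow> (real \<Rightarrow> real) \<Rightarrow> bool" where
  "is_poly_deg d f \<longleftrightarrow> (\<exists>P. degree P \<le> d \<and> (\<forall>t. f t = poly P t))"

lemma is_poly_deg_mono: "is_poly_deg d f \<Longrightarrow> d \<le> e \<Longrightarrow> is_poly_deg e f"
  unfolding is_poly_deg_def by force

lemma is_poly_deg_const: "is_poly_deg d (\<lambda>t. a)"
  unfolding is_poly_deg_def by (rule exI[of _ "[:a:]"]) auto

lemma is_poly_deg_add:
  "is_poly_deg d f \<Longrightarrow> is_poly_deg d g \<Longrightarrow> is_poly_deg d (\<lambda>t. f t + g t)"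
  unfolding is_poly_deg_def by (metis degree_add_le poly_add)

lemma is_poly_deg_mult:
  "is_poly_deg d f \<Longrightarrow> is_poly_deg e g \<Longrightarrow> is_poly_deg (d + e) (\<lambda>t. f t * g t)"
  unfolding is_poly_deg_def by (metis degree_mult_le poly_mult add_mono order_trans)

lemma is_poly_deg_cmult: "is_poly_deg d f \<Longrightarrow> is_poly_deg d (\<lambda>t. a * f t)"
  using is_poly_deg_mult[OF is_poly_deg_const[of 0 a]] by simp

lemma is_poly_deg_power: "is_poly_deg k (\<lambda>t. t ^ k)"
  unfolding is_poly_deg_def
  by (rule exI[of _ "monom 1 k"]) (auto simp: poly_monom degree_monom_le)

lemma is_poly_deg_sum:
  "(\<And>i. i \<in> I \<Longrightarrow> is_poly_deg d (f i)) \<Longrightarrow> is_poly_deg d (\<lambda>t. \<Sum>i\<in>I. f i t)"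
  by (induction I rule: infinite_finite_induct)
     (auto intro: is_poly_deg_const is_poly_deg_add)

lemma is_poly_deg_shift: "is_poly_deg d f \<Longrightarrow> is_poly_deg d (\<lambda>t. f (t + a))"
  unfolding is_poly_deg_def
proof (elim exE conjE)
  fix P assume P: "degree P \<le> d" "\<forall>t. f t = poly P t"
  show "\<exists>Q. degree Q \<le> d \<and> (\<forall>t. f (t + a) = poly Q t)"
    using P by (intro exI[of _ "pcompose P [:a, 1:]"])
      (auto simp: poly_pcompose degree_pcompose add.commute)
qed

lemma bernpoly_poly:
  obtains P where "\<And>t. bernpoly n t = poly P t" "degree P \<le> n" "coeff P n = 1"
proof -
  define G :: "real fps" where "G = fps_X / (fps_exp 1 - 1)"
  define E :: "real fps" where "E = fps_exp 1 - 1"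
  have E0: "fps_nth E 0 = 0" "fps_nth E 1 = 1" by (simp_all add: E_def)
  have sE: "subdegree E = 1" by (rule subdegreeI) (use E0 in auto)
  have G0: "fps_nth G 0 = 1"
    using fps_divide_nth_0[of E fps_X] E0 sE
    unfolding G_def E_def[symmetric] by (auto simp: fps_divide_nth_below fps_divide_def)
  define P where "P = (\<Sum>i\<le>n. monom (fact n * fps_nth G i / fact (n - i)) (n - i))"
  have "bernpoly n t = poly P t" for t
    unfolding bernpoly_def G_def[symmetric] P_def
    by (simp add: fps_mult_nth poly_sum poly_monom sum_distrib_left atLeast0AtMost mult_ac)
  moreover have "degree P \<le> n"
    unfolding P_def by (intro degree_sum_le) (auto intro: order_trans[OF degree_monom_le])
  moreover have "coeff P n = 1"
  proof -
    have "coeff P n = (\<Sum>i\<le>n. if i = 0 then fact n * fps_nth G i / fact (n - i) else 0)"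
      unfolding P_def coeff_sum by (intro sum.cong) auto
    also have "\<dots> = 1" using G0 by simp
    finally show ?thesis .
  qed
  ultimately show ?thesis using that by blast
qed

lemma is_poly_deg_bernpoly: "is_poly_deg n (bernpoly n)"
  using bernpoly_poly[of n] unfolding is_poly_deg_def by metis

lemma is_poly_deg_A_coeff: "is_poly_deg (k + 1) (\<lambda>t. A_coeff k t p)"
proof -
  have 1: "is_poly_deg (k + 1) (\<lambda>t. a * (b - d * bernpoly (k + 1) t) + e * t ^ k)" for a b d e
    using is_poly_deg_add[OF is_poly_deg_cmult[OF is_poly_deg_add[OF is_poly_deg_const
        is_poly_deg_cmult[OF is_poly_deg_bernpoly[of "k + 1"], where a = "- d"]]]
        is_poly_deg_cmult[OF is_poly_deg_mono[OF is_poly_deg_power]], of k a b e]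
    by simp
  show ?thesis
    unfolding A_coeff_def
    using 1[of "(-1) ^ (k + 1) / (real k * real (k + 1))" "bernoulli (k + 1)"
        "1 / p ^ k + (-1) ^ (k + 1) * (1 / (1 - p) ^ k)" "(-1) ^ k / (real k * p ^ k)"]
    by (simp add: field_simps)
qed

lemma is_poly_deg_A_series: "is_poly_deg (2 * k) (\<lambda>t. fps_nth (A_series t p) k)"
proof (cases "k = 0")
  case False
  then show ?thesis
    using is_poly_deg_mono[OF is_poly_deg_A_coeff[of k p], of "2 * k"]
    by (simp add: A_series_def)
qed (simp add: A_series_def is_poly_deg_const)

lemma is_poly_deg_A_series_power: "is_poly_deg (2 * n) (\<lambda>t. fps_nth (A_series t p ^ i) n)"
proof (induction i arbitrary: n)
  case 0
  then show ?case by (simp add: is_poly_deg_const)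
next
  case (Suc i)
  have "is_poly_deg (2 * n)
      (\<lambda>t. \<Sum>j=0..n. fps_nth (A_series t p) j * fps_nth (A_series t p ^ i) (n - j))"
  proof (rule is_poly_deg_sum)
    fix j assume "j \<in> {0..n}"
    then show "is_poly_deg (2 * n)
        (\<lambda>t. fps_nth (A_series t p) j * fps_nth (A_series t p ^ i) (n - j))"
      using is_poly_deg_mult[OF is_poly_deg_A_series[of j p] Suc[of "n - j"]]
      by (auto elim: is_poly_deg_mono)
  qed
  then show ?case by (simp add: fps_mult_nth)
qed

lemma is_poly_deg_c_coeff: "is_poly_deg (2 * n) (\<lambda>t. c_coeff n t p)"
  unfolding c_coeff_def fps_compose_nth
  by (rule is_poly_deg_sum, rule is_poly_deg_cmult, rule is_poly_deg_A_series_power)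

lemma bernoulli_expansion_exists:
  assumes "is_poly_deg d f"
  shows "\<exists>g. \<forall>h. f h = (\<Sum>j\<le>d. g j * bernpoly j h)"
  using assms
proof (induction d arbitrary: f)
  case 0
  then obtain P where P: "degree P \<le> 0" "\<forall>t. f t = poly P t"
    by (auto simp: is_poly_deg_def)
  then obtain a where a: "P = [:a:]" by (metis degree_eq_zeroE le_zero_eq)
  obtain B where B: "\<And>t. bernpoly 0 t = poly B t" "degree B \<le> 0" "coeff B 0 = 1"
    using bernpoly_poly[of 0] by metis
  from B obtain b where "B = [:b:]" by (metis degree_eq_zeroE le_zero_eq)
  with B P a show ?case by (intro exI[of _ "\<lambda>_. a"]) auto
next
  case (Suc d)
  then obtain P where P: "degree P \<le> Suc d" "\<forall>t. f t = poly P t"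
    by (auto simp: is_poly_deg_def)
  obtain B where B: "\<And>t. bernpoly (Suc d) t = poly B t" "degree B \<le> Suc d" "coeff B (Suc d) = 1"
    using bernpoly_poly[of "Suc d"] by metis
  define a where "a = coeff P (Suc d)"
  have "degree (P - smult a B) \<le> d"
  proof (rule degree_le, intro allI impI)
    fix i assume "d < i"
    then show "coeff (P - smult a B) i = 0"
      using P(1) B(2,3) by (cases "i = Suc d") (auto simp: a_def coeff_eq_0)
  qed
  then have "is_poly_deg d (\<lambda>t. f t - a * bernpoly (Suc d) t)"
    unfolding is_poly_deg_def using P B by (intro exI[of _ "P - smult a B"]) auto
  from Suc.IH[OF this] obtain g where
    g: "\<And>h. f h - a * bernpoly (Suc d) h = (\<Sum>j\<le>d. g j * bernpoly j h)" by auto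
  show ?case
  proof (intro exI[of _ "g(Suc d := a)"] allI)
    fix h
    have "(\<Sum>j\<le>d. (g(Suc d := a)) j * bernpoly j h) = (\<Sum>j\<le>d. g j * bernpoly j h)"
      by (intro sum.cong) auto
    then show "f h = (\<Sum>j\<le>Suc d. (g(Suc d := a)) j * bernpoly j h)"
      using g[of h] by (simp add: algebra_simps)
  qed
qed

lemma bernpoly_independent:
  assumes "\<And>h. (\<Sum>j\<le>d. g j * bernpoly j h) = 0" and "j \<le> d"
  shows "g j = 0"
  using assms
proof (induction d arbitrary: j)
  case 0
  obtain B where B: "\<And>t. bernpoly 0 t = poly B t" "degree B \<le> 0" "coeff B 0 = 1"
    using bernpoly_poly[of 0] by metis
  have "bernpoly 0 0 = 1" using B by (simp add: poly_0_coeff_0)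
  with 0(1)[of 0] 0(2) show ?case by simp
next
  case (Suc d)
  have "\<exists>P. (\<forall>t. bernpoly j t = poly P t) \<and> degree P \<le> j \<and> coeff P j = 1" for j
    by (rule bernpoly_poly[of j]) blast
  then have "\<exists>B. \<forall>j. (\<forall>t. bernpoly j t = poly (B j) t) \<and> degree (B j) \<le> j \<and> coeff (B j) j = 1"
    by (intro choice) blast
  then obtain B where B: "\<And>j t. bernpoly j t = poly (B j) t"
    "\<And>j. degree (B j) \<le> j" "\<And>j. coeff (B j) j = 1" by blast
  define Q where "Q = (\<Sum>j\<le>Suc d. smult (g j) (B j))"
  have "poly Q = poly 0"
    using Suc.prems(1) by (intro ext) (simp add: Q_def poly_sum B(1))
  then have "Q = 0" using poly_eq_poly_eq_iff by blast
  then have "0 = coeff Q (Suc d)" by simp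
  also have "\<dots> = (\<Sum>j\<le>d. g j * coeff (B j) (Suc d)) + g (Suc d)"
    by (simp add: Q_def coeff_sum B(3))
  also have "(\<Sum>j\<le>d. g j * coeff (B j) (Suc d)) = 0"
    by (intro sum.neutral) (auto intro!: coeff_eq_0 le_less_trans[OF B(2)])
  finally have z: "g (Suc d) = 0" by simp
  then have "(\<Sum>j\<le>d. g j * bernpoly j h) = 0" for h
    using Suc.prems(1)[of h] by simp
  then show ?case using Suc.IH[of j] Suc.prems(2) z by (cases "j = Suc d") auto
qed

lemma gamma_coeff_unique: "\<exists>!g. is_bernoulli_expansion n r p g"
proof -
  from bernoulli_expansion_exists[OF is_poly_deg_shift[OF is_poly_deg_c_coeff]]
  obtain g where g: "\<And>h. c_coeff n (h + of_int r) p = (\<Sum>j\<le>2 * n. g j * bernpoly j h)"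
    by metis
  show ?thesis
  proof (rule ex1I)
    show "is_bernoulli_expansion n r p (\<lambda>j. if j \<le> 2 * n then g j else 0)"
      using g by (auto simp: is_bernoulli_expansion_def intro!: sum.cong)
  next
    fix g' assume g': "is_bernoulli_expansion n r p g'"
    have "(\<Sum>j\<le>2 * n. (g' j - g j) * bernpoly j h) = 0" for h
      using g g' by (simp add: is_bernoulli_expansion_def left_diff_distrib sum_subtractf)
    then have "g' j - g j = 0" if "j \<le> 2 * n" for j
      using bernpoly_independent[where d = "2 * n" and g = "\<lambda>j. g' j - g j"] that by blast
    then show "g' = (\<lambda>j. if j \<le> 2 * n then g j else 0)"
      using g' by (auto simp: is_bernoulli_expansion_def fun_eq_iff)
  qed
qed

lemma c_coeff_bernoulli_expansion:
  "c_coeff n (h + of_int r) p = (\<Sum>j\<le>2 * n. gamma_coeff n j r p * bernpoly j h)"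
  using theI'[OF gamma_coeff_unique[of n r p]]
  unfolding is_bernoulli_expansion_def gamma_coeff_def by blast

end

theory Submission
  imports Defs
begin

text \<open>
  Everything reduces to the Bernoulli polynomials. Since \<open>B\<^sub>j = B\<^sub>j\<^sub>+\<^sub>1' / (j + 1)\<close> and
  \<open>B\<^sub>j\<^sub>+\<^sub>1(1) = B\<^sub>j\<^sub>+\<^sub>1(0)\<close> for \<open>j \<ge> 1\<close>, only the term \<open>j = 0\<close> contributes to the integral over
  \<open>[0,1]\<close>; the multiplication theorem at \<open>0\<close> gives the mean of \<open>B\<^sub>j\<close> over \<open>0, 1/b, \<dots>, (b-1)/b\<close>.
  For irrational \<open>p\<close>, take a reduced fraction with \<open>\<bar>p - a/b\<bar> < 1/b\<^sup>2\<close>. Along any \<open>b\<close>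
  consecutive \<open>N\<close> the points \<open>- N p\<close> stay, up to a common translation, within \<open>1/b\<close> of the points
  \<open>- N a/b\<close>, which run once through the multiples of \<open>1/b\<close> modulo 1. So an interval of length
  \<open>\<ell>\<close> receives at most \<open>b \<ell> + O(1)\<close> of them, and \<open>b\<close> can be taken arbitrarily large.
\<close>

subsection \<open>Bernoulli polynomials\<close>

text \<open>Both series have subdegree 1, so this division of formal power series is exact. The
  shift and multiplication identities clear the denominator through it.\<close>

lemma bernpoly_gen_mult:
  "fps_X / (fps_exp 1 - 1) * (fps_exp 1 - 1) = (fps_X :: real fps)"
proof -
  let ?E = "fps_exp 1 - 1 :: real fps"
  have "subdegree ?E = 1"
    by (rule subdegreeI) auto
  moreover have "?E \<noteq> 0"
    using calculation by force
  ultimately have "?E dvd fps_X"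
    by (simp add: fps_dvd_iff)
  then show ?thesis
    by (rule dvd_div_mult_self)
qed

lemma bernpoly_fps_nth:
  "fps_nth (fps_X / (fps_exp 1 - 1) * fps_exp t) n = bernpoly n t / fact n"
  by (simp add: bernpoly_def)

text \<open>Cauchy product with the exponential series; the explicit form permits differentiation
  term by term.\<close>

lemma bernpoly_eq_sum:
  "bernpoly n t = (\<Sum>i\<le>n. real (n choose i) * bernoulli i * t ^ (n - i))"
proof -
  define G :: "real fps" where "G = fps_X / (fps_exp 1 - 1)"
  have G: "fps_nth G i = bernoulli i / fact i" for i
    by (simp add: bernoulli_def bernpoly_def G_def)
  have "bernpoly n t = fact n * (\<Sum>i\<le>n. bernoulli i / fact i * (t ^ (n - i) / fact (n - i)))"
    by (simp only: bernpoly_def flip: G_def) (simp add: fps_mult_nth G atLeast0AtMost)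
  then show ?thesis
    by (auto simp: sum_distrib_left binomial_fact field_simps intro!: sum.cong)
qed

lemma bernpoly_0 [simp]: "bernpoly 0 t = 1"
proof -
  obtain P where "\<And>t. bernpoly 0 t = poly P t" "coeff P 0 = 1"
    using bernpoly_poly[of 0] by metis
  then have "bernoulli 0 = 1"
    by (simp add: bernoulli_def poly_0_coeff_0)
  then show ?thesis
    by (simp add: bernpoly_eq_sum)
qed

lemma has_real_derivative_bernpoly:
  "(bernpoly (Suc n) has_real_derivative real (Suc n) * bernpoly n t) (at t within S)"
proof -
  have "((\<lambda>t. \<Sum>i\<le>Suc n. real (Suc n choose i) * bernoulli i * t ^ (Suc n - i))
      has_real_derivative
      (\<Sum>i\<le>Suc n. real (Suc n choose i) * bernoulli i * (real (Suc n - i) * t ^ (n - i))))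
      (at t within S)"
    by (auto intro!: derivative_eq_intros sum.cong)
  \<comment> \<open>The term \<open>i = Suc n\<close> is killed by the factor
    \<open>Suc n - i\<close>; binomial absorption handles the others.\<close>
  moreover have "(\<Sum>i\<le>Suc n. real (Suc n choose i) * bernoulli i * (real (Suc n - i) * t ^ (n - i)))
      = (\<Sum>i\<le>n. real (Suc n) * (real (n choose i) * bernoulli i * t ^ (n - i)))"
  proof -
    have "real (Suc n choose i) * real (Suc n - i) = real (Suc n) * real (n choose i)"
      if "i \<le> n" for i
      using binomial_absorb_comp[of "Suc n" i] by (metis diff_Suc_1 mult.commute of_nat_mult)
    then show ?thesis
      by (auto intro!: sum.cong simp: mult_ac)
  qed
  ultimately show ?thesis
    by (simp add: bernpoly_eq_sum[abs_def] sum_distrib_left del: of_nat_Suc)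
qed

text \<open>Raising \<open>t\<close> by 1 multiplies the generating function by
  \<open>exp x\<close>, so the difference cancels the denominator and leaves
  \<open>x * exp (t * x)\<close>.\<close>

lemma bernpoly_plus_1: "bernpoly (Suc n) (t + 1) - bernpoly (Suc n) t = real (Suc n) * t ^ n"
proof -
  let ?G = "fps_X / (fps_exp 1 - 1) :: real fps"
  have "?G * fps_exp (t + 1) - ?G * fps_exp t = (?G * (fps_exp 1 - 1)) * fps_exp t"
    by (simp add: fps_exp_add_mult algebra_simps)
  also have "\<dots> = fps_X * fps_exp t"
    by (simp only: bernpoly_gen_mult)
  finally have "fps_nth (?G * fps_exp (t + 1) - ?G * fps_exp t) (Suc n)
      = fps_nth (fps_X * fps_exp t) (Suc n)"
    by simp
  then have "(bernpoly (Suc n) (t + 1) - bernpoly (Suc n) t) / fact (Suc n) = t ^ n / fact n"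
    by (simp only: fps_sub_nth bernpoly_fps_nth diff_divide_distrib) simp
  then have "(bernpoly (Suc n) (t + 1) - bernpoly (Suc n) t) / fact (Suc n)
      = (real (Suc n) * t ^ n) / fact (Suc n)"
    by simp
  then show ?thesis
    by (metis fact_nonzero nonzero_eq_divide_eq times_divide_eq_left)
qed

text \<open>Both sides of the generating function identity agree after multiplication
  by \<open>exp (x / b) - 1\<close>.\<close>

lemma bernpoly_multiplication_0:
  assumes "b > 0"
  shows "(\<Sum>i<b. bernpoly n (real i / real b)) = real b * (1 / real b ^ n) * bernoulli n"
proof -
  let ?G = "fps_X / (fps_exp 1 - 1) :: real fps"
  define c where "c = 1 / real b"
  let ?e = "fps_exp c - 1 :: real fps"
  define L where "L = fps_const c * fps_X"
  have "fps_nth ?e 1 \<noteq> 0"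
    using assms by (simp add: c_def)
  then have e: "?e \<noteq> 0"
    by force
  have pow: "fps_exp (real i / real b) = fps_exp c ^ i" for i
    by (simp add: fps_exp_power_mult c_def)
  \<comment> \<open>\<open>L\<close> is \<open>x / b\<close>; substituting it into the defining
    identity turns the denominator into \<open>?e\<close>.\<close>
  have "(?G oo L) * ?e = (?G oo L) * ((fps_exp 1 - 1) oo L)"
    by (simp add: L_def fps_compose_sub_distrib)
  also have "\<dots> = (?G * (fps_exp 1 - 1)) oo L"
    by (simp add: L_def fps_compose_mult_distrib)
  also have "\<dots> = L"
    by (simp only: bernpoly_gen_mult) (simp add: L_def)
  finally have 1: "fps_const (real b) * (?G oo L) * ?e = fps_X"
    using assms by (simp add: L_def c_def mult.assoc flip: fps_const_mult)
  \<comment> \<open>Geometric sum of powers of \<open>fps_exp c\<close>, whose \<open>b\<close>-th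
    power is \<open>fps_exp 1\<close>.\<close>
  have "(\<Sum>i<b. fps_exp (real i / real b)) * ?e = fps_exp 1 - 1"
    using power_diff_1_eq[of "fps_exp c" b] assms
    by (simp add: pow mult.commute) (simp add: fps_exp_power_mult c_def)
  then have "?G * (\<Sum>i<b. fps_exp (real i / real b)) * ?e = fps_X"
    using bernpoly_gen_mult by (metis mult.assoc)
  with 1 e have "?G * (\<Sum>i<b. fps_exp (real i / real b)) = fps_const (real b) * (?G oo L)"
    by (metis mult_right_cancel)
  then have "fps_nth (\<Sum>i<b. ?G * fps_exp (real i / real b)) n
      = fps_nth (fps_const (real b) * (?G oo L)) n"
    by (simp add: sum_distrib_left)
  then have "(\<Sum>i<b. bernpoly n (real i / real b)) / fact n
      = real b * (c ^ n * fps_nth ?G n)"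
    by (simp add: fps_sum_nth bernpoly_fps_nth L_def fps_compose_linear sum_divide_distrib)
  then show ?thesis
    by (simp add: bernoulli_def bernpoly_def c_def field_simps)
qed

lemma bernoulli_0 [simp]: "bernoulli 0 = 1"
  by (simp add: bernoulli_def)

text \<open>The multiplication theorem with \<open>b = 2\<close> and \<open>n = 1\<close> reads
  \<open>B_1(0) + B_1(1/2) = B_1\<close>, where \<open>B_1(t) = t + B_1\<close>.\<close>

lemma bernoulli_1: "bernoulli 1 = - 1 / 2"
proof -
  have "bernpoly 1 t = t + bernoulli 1" for t
    by (simp add: bernpoly_eq_sum)
  then show ?thesis
    using bernpoly_multiplication_0[of 2 1] by (simp add: numeral_2_eq_2)
qed

subsection \<open>Distribution of the sequence\<close>

text \<open>Coprimality permits cancelling \<open>a\<close> modulo \<open>b\<close>, hence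
  injectivity; equal cardinalities give surjectivity. The offset \<open>s\<close> is zero for
  rational \<open>p\<close> and a rounded starting error in the irrational case.\<close>

lemma bij_betw_affine_mod:
  fixes a s :: int
  assumes "b > 0" "coprime a (int b)"
  shows "bij_betw (\<lambda>i. (s + int i * a) mod int b) {K..<K + b} {0..<int b}"
proof -
  let ?f = "\<lambda>i. (s + int i * a) mod int b"
  have inj: "inj_on ?f {K..<K + b}"
  proof (rule inj_onI)
    fix i j assume ij: "i \<in> {K..<K + b}" "j \<in> {K..<K + b}" "?f i = ?f j"
    then have "int b dvd (int i - int j) * a"
      by (simp add: mod_eq_dvd_iff algebra_simps)
    then have "int b dvd int i - int j"
      using assms(2) by (simp add: coprime_commute coprime_dvd_mult_left_iff)
    moreover have "\<bar>int i - int j\<bar> < int b"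
      using ij by auto
    ultimately show "i = j"
      using dvd_imp_le_int[of "int i - int j" "int b"] by force
  qed
  moreover have "?f ` {K..<K + b} = {0..<int b}"
    using assms by (intro card_subset_eq) (auto simp: card_image[OF inj])
  ultimately show ?thesis
    by (simp add: bij_betw_def)
qed

lemma h_seq_bounds: "0 \<le> h_seq p N" "h_seq p N < 1"
  unfolding h_seq_def by linarith+

section \<open>Rational \<open>p\<close>: values over one period and periodicity\<close>

lemma h_seq_rational:
  assumes "b > 0" "p = of_int a / real b"
  shows "h_seq p N = of_int ((- (int N * a)) mod int b) / real b"
proof -
  have "real N * p = of_int (int N * a) / of_int (int b)"
    using assms by simp
  \<comment> \<open>A ceiling is a negated floor quotient, so \<open>b * h_seq p N\<close> is the
    remainder of \<open>- N * a\<close> modulo \<open>b\<close>.\<close>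
  then have "\<lceil>real N * p\<rceil> = - ((- (int N * a)) div int b)"
    by (simp only: ceiling_divide_eq_div)
  moreover have "of_int ((- (int N * a)) mod int b)
      = - (real N * of_int a) - of_int ((- (int N * a)) div int b) * real b"
    by (simp flip: minus_div_mult_eq_mod)
  ultimately show ?thesis
    using assms(1) by (simp add: h_seq_def assms(2) diff_divide_distrib)
qed

lemma bij_betw_h_seq:
  assumes "b > 0" "coprime a (int b)" "p = of_int a / real b"
  shows "bij_betw (h_seq p) {K..<K + b} ((\<lambda>i. real i / real b) ` {0..<b})"
proof -
  have "bij_betw (\<lambda>N. (0 + int N * (- a)) mod int b) {K..<K + b} {0..<int b}"
    using assms by (intro bij_betw_affine_mod) auto
  moreover have "bij_betw (\<lambda>z. of_int z / real b) {0..<int b} ((\<lambda>z. of_int z / real b) ` {0..<int b})"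
    using assms by (intro inj_on_imp_bij_betw inj_onI) auto
  ultimately have "bij_betw ((\<lambda>z. of_int z / real b) \<circ> (\<lambda>N. (0 + int N * (- a)) mod int b))
      {K..<K + b} ((\<lambda>z. of_int z / real b) ` {0..<int b})"
    by (rule bij_betw_trans)
  moreover have "(\<lambda>z. of_int z / real b) \<circ> (\<lambda>N. (0 + int N * (- a)) mod int b) = h_seq p"
    by (auto simp: h_seq_rational[OF assms(1,3)])
  moreover have "{0..<int b} = int ` {0..<b}"
    by (simp add: image_int_atLeastLessThan)
  ultimately show ?thesis
    by (simp add: image_image)
qed

lemma h_seq_periodic:
  assumes "b > 0" "p = of_int a / real b"
  shows "h_seq p (N + b) = h_seq p N"
proof -
  have "(- (int (N + b) * a)) mod int b = (- (int N * a)) mod int b"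
    by (simp add: mod_eq_dvd_iff algebra_simps)
  then show ?thesis
    by (simp only: h_seq_rational[OF assms])
qed

section \<open>Irrational \<open>p\<close>: counting visits through rational approximation\<close>

lemma h_seq_cong_mod_1:
  obtains z where "h_seq p N = - (real N * p) + of_int z"
  unfolding h_seq_def by (metis uminus_add_conv_diff)

text \<open>Over the block, \<open>r N\<close> runs once through the residues modulo
  \<open>b\<close>, and a visit of \<open>h_seq p N\<close> to the interval forces
  \<open>r N\<close> into the set \<open>T\<close>. Counting \<open>T\<close> bounds the visits
  uniformly in \<open>K\<close>.\<close>

lemma card_h_seq_block_le:
  fixes a :: int
  assumes "b > 0" "coprime a (int b)" "\<bar>p - of_int a / real b\<bar> < 1 / (real b)\<^sup>2"
    and "0 \<le> u" "u < v" "v \<le> 1"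
  shows "real (card {N \<in> {K..<K + b}. h_seq p N \<in> {u..<v}}) \<le> real b * (v - u) + 11"
proof -
  let ?B = "real b"
  define e where "e = p - of_int a / ?B"
  \<comment> \<open>The scaled error accumulated at the start of the block is rounded down, leaving
    a remainder in [0,1).\<close>
  define s where "s = \<lfloor>- (real K * e * ?B)\<rfloor>"
  define r where "r N = (s + int N * (- a)) mod int b" for N
  \<comment> \<open>The integer interval serves when there is no wraparound (\<open>w = 0\<close>);
    the four residues at the ends catch \<open>w >= 1\<close> and \<open>w <= -1\<close>.\<close>
  define T where "T = {\<lceil>?B * u - 2\<rceil>..\<lfloor>?B * v + 1\<rfloor>} \<union> {0, 1, int b - 2, int b - 1}"
  have bij: "bij_betw r {K..<K + b} {0..<int b}"
    unfolding r_def using assms by (intro bij_betw_affine_mod) auto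
  have "r N \<in> T" if N: "N \<in> {K..<K + b}" and h: "h_seq p N \<in> {u..<v}" for N
  proof -
    obtain z where z: "h_seq p N = - (real N * p) + of_int z"
      by (rule h_seq_cong_mod_1)
    define y where "y = (s - int N * a) div int b"
    define w where "w = z + y"
    have r: "of_int (r N) = of_int s - real N * of_int a - ?B * of_int y"
      by (simp add: r_def y_def minus_div_mult_eq_mod[symmetric] algebra_simps
           flip: minus_mult_div_eq_mod of_int_mult)
         (metis of_int_mult of_int_of_nat_eq mult.commute)
    have rb: "0 \<le> r N" "r N < int b"
      using assms(1) by (auto simp: r_def)
    have pe: "?B * p = of_int a + ?B * e"
      using assms(1) by (simp add: e_def field_simps)
    \<comment> \<open>Drift of the scaled error within the block: at most \<open>b\<close> steps,
      each of absolute size at most \<open>1 / b\<close>.\<close>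
    define d where "d = (real N - real K) * (?B * e)"
    have "\<bar>?B * e\<bar> \<le> 1 / ?B"
    proof -
      have "\<bar>?B * e\<bar> = ?B * \<bar>e\<bar>" by (simp add: abs_mult)
      also have "\<dots> \<le> ?B * (1 / ?B\<^sup>2)"
        using assms(3) by (intro mult_left_mono) (auto simp: e_def)
      finally show ?thesis using assms(1) by (simp add: power2_eq_square)
    qed
    moreover have "\<bar>real N - real K\<bar> \<le> ?B"
      using N by auto
    ultimately have "\<bar>d\<bar> \<le> ?B * (1 / ?B)"
      unfolding d_def abs_mult by (intro mult_mono) auto
    then have d: "\<bar>d\<bar> \<le> 1"
      using assms(1) by simp
    have "?B * h_seq p N = ?B * of_int z - real N * (?B * p)"
      by (simp add: z algebra_simps)
    also have "\<dots> = ?B * of_int z - real N * (of_int a + ?B * e)"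
      by (simp only: pe)
    also have "\<dots> = of_int (r N) + ?B * of_int w + (- (real K * e * ?B) - of_int s) - d"
      by (simp add: r w_def d_def algebra_simps)
    finally have eq: "?B * h_seq p N
      = of_int (r N) + ?B * of_int w + (- (real K * e * ?B) - of_int s) - d" .
    have s: "0 \<le> - (real K * e * ?B) - of_int s" "- (real K * e * ?B) - of_int s < 1"
      unfolding s_def by linarith+
    have hB: "?B * u \<le> ?B * h_seq p N" "?B * h_seq p N < ?B * v"
      using h assms(1) by auto
    have uv: "0 \<le> ?B * u" "?B * v \<le> ?B"
      using assms by (auto simp: mult_left_le)
    consider "w = 0" | "w \<ge> 1" | "w \<le> -1"
      by linarith
    then show ?thesis
    proof cases
      case 1
      then have "?B * u - 2 \<le> of_int (r N)" "of_int (r N) \<le> ?B * v + 1"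
        using eq s d hB by auto
      then have "\<lceil>?B * u - 2\<rceil> \<le> r N" "r N \<le> \<lfloor>?B * v + 1\<rfloor>"
        by (simp_all only: ceiling_le_iff le_floor_iff)
      then show ?thesis
        by (auto simp: T_def)
    next
      case 2
      then have "?B * 1 \<le> ?B * of_int w"
        by (intro mult_left_mono) auto
      then have "of_int (r N) < (2 :: real)"
        using eq s d hB uv by linarith
      then show ?thesis
        using rb by (auto simp: T_def)
    next
      case 3
      then have "?B * of_int w \<le> ?B * (- 1)"
        by (intro mult_left_mono) auto
      then have "real b - 2 \<le> of_int (r N)"
        using eq s d hB uv by linarith
      then have "int b - 2 \<le> r N"
        by linarith
      then show ?thesis
        using rb by (auto simp: T_def)
    qed
  qed
  moreover have "finite T"
    by (simp add: T_def)
  moreover have "inj_on r {N \<in> {K..<K + b}. h_seq p N \<in> {u..<v}}"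
    by (rule inj_on_subset[OF bij_betw_imp_inj_on[OF bij]]) auto
  ultimately have "card {N \<in> {K..<K + b}. h_seq p N \<in> {u..<v}} \<le> card T"
    by (intro card_inj_on_le[where f = r]) blast+
  also have "\<dots> \<le> card {\<lceil>?B * u - 2\<rceil>..\<lfloor>?B * v + 1\<rfloor>} + card {0, 1, int b - 2, int b - 1}"
    unfolding T_def by (rule card_Un_le)
  also have "card {0, 1, int b - 2, int b - 1} \<le> 4"
    using card_length[of "[0, 1, int b - 2, int b - 1]"] by simp
  also have "card {\<lceil>?B * u - 2\<rceil>..\<lfloor>?B * v + 1\<rfloor>} = nat (\<lfloor>?B * v + 1\<rfloor> - \<lceil>?B * u - 2\<rceil> + 1)"
    by (rule card_atLeastAtMost_int)
  finally have "real (card {N \<in> {K..<K + b}. h_seq p N \<in> {u..<v}})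
      \<le> real (nat (\<lfloor>?B * v + 1\<rfloor> - \<lceil>?B * u - 2\<rceil> + 1)) + 4"
    by linarith
  also have "\<dots> \<le> ?B * v + 1 + 1 - (?B * u - 2) + 4"
  proof -
    have "?B * u \<le> ?B * v" using assms by simp
    then show ?thesis by linarith
  qed
  \<comment> \<open>The constants add up to 8, so 11 leaves slack.\<close>
  finally show ?thesis
    by (simp add: algebra_simps)
qed

text \<open>\<open>M div b + 1\<close> full blocks cover \<open>{1..M}\<close>; overcounting the
  last one costs an amount that is bounded for fixed \<open>b\<close>.\<close>

lemma card_h_seq_le:
  fixes a :: int
  assumes "b > 0" "coprime a (int b)" "\<bar>p - of_int a / real b\<bar> < 1 / (real b)\<^sup>2"
    and "0 \<le> u" "u < v" "v \<le> 1"
  shows "real (card {N \<in> {1..M}. h_seq p N \<in> {u..<v}})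
    \<le> (real M / real b + 1) * (real b * (v - u) + 11)"
proof -
  let ?c = "real b * (v - u) + 11"
  let ?A = "\<lambda>S. {N \<in> S. h_seq p N \<in> {u..<v}}"
  have blocks: "real (card (?A {1..<1 + m * b})) \<le> real m * ?c" for m
  proof (induction m)
    case (Suc m)
    have "?A {1..<1 + Suc m * b} = ?A {1..<1 + m * b} \<union> ?A {1 + m * b..<(1 + m * b) + b}"
      by auto
    then have "card (?A {1..<1 + Suc m * b})
        \<le> card (?A {1..<1 + m * b}) + card (?A {1 + m * b..<(1 + m * b) + b})"
      by (simp only: card_Un_le)
    then show ?case
      using Suc card_h_seq_block_le[OF assms, of "1 + m * b"] by (simp add: algebra_simps)
  qed simp
  have "M < (M div b + 1) * b"
    using dividend_less_div_times[OF assms(1), of M] by (simp add: algebra_simps)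
  then have "card (?A {1..M}) \<le> card (?A {1..<1 + (M div b + 1) * b})"
    by (intro card_mono) auto
  also have "real \<dots> \<le> real (M div b + 1) * ?c"
    by (rule blocks)
  also have "\<dots> \<le> (real M / real b + 1) * ?c"
    using assms(5) of_nat_div_le_of_nat[of M b, where ?'a = real] by (intro mult_right_mono) auto
  finally show ?thesis by simp
qed

text \<open>After division by \<open>M\<close> the bound exceeds \<open>v - u\<close> by
  \<open>11 / b\<close> plus a term tending to 0, and irrationality supplies reduced approximations
  with arbitrarily large \<open>b\<close>. The case \<open>u = v\<close> is included because the
  complementary intervals used below can be empty.\<close>

lemma eventually_h_seq_freq_le:
  assumes "p \<notin> \<rat>" "0 \<le> u" "u \<le> v" "v \<le> 1" "\<epsilon> > 0"
  shows "eventually (\<lambda>M. real (card {N \<in> {1..M}. h_seq p N \<in> {u..<v}}) / real M < v - u + \<epsilon>)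
    sequentially"
proof (cases "u = v")
  case False
  then have uv: "u < v" using assms by simp
  have "infinite (approx_set p)"
    using assms(1) rational_iff_finite_approx_set by blast
  \<comment> \<open>The threshold \<open>22 / \<epsilon>\<close> makes \<open>11 / b\<close> smaller
    than \<open>\<epsilon> / 2\<close>.\<close>
  then obtain a k where ak: "(a, k) \<in> approx_set p" "k > \<lceil>22 / \<epsilon>\<rceil>"
    using infinite_approx_set by blast
  define b where "b = nat k"
  have k: "k = int b" and b: "b > 0" "coprime a (int b)"
    "\<bar>p - of_int a / real b\<bar> < 1 / (real b)\<^sup>2"
    using ak by (auto simp: approx_set_def b_def)
  have "22 / \<epsilon> < real b"
    using ak(2) unfolding k by linarith
  then have *: "11 / real b < \<epsilon> / 2"
    using assms(5) b(1) by (simp add: field_simps)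
  let ?c = "real b * (v - u) + 11"
  have "(\<lambda>M. ?c / real M) \<longlonglongrightarrow> 0"
    by (rule lim_const_over_n)
  then have "eventually (\<lambda>M. ?c / real M < \<epsilon> / 2) sequentially"
    using assms(5) by (intro order_tendstoD) auto
  then show ?thesis
    using eventually_gt_at_top[of 0]
  proof eventually_elim
    case (elim M)
    have "real (card {N \<in> {1..M}. h_seq p N \<in> {u..<v}}) / real M
        \<le> ((real M / real b + 1) * ?c) / real M"
      using card_h_seq_le[OF b assms(2) uv assms(4)] by (intro divide_right_mono) auto
    also have "\<dots> = (v - u) + 11 / real b + ?c / real M"
      using elim b(1) by (simp add: field_simps)
    finally show ?case using elim * by linarith
  qed
qed (use assms in auto)

text \<open>The lower bound on a frequency is the upper bound on the complementary intervals.\<close>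

lemma equidistributed_h_seq:
  assumes "p \<notin> \<rat>"
  shows "equidistributed_01 (h_seq p)"
  unfolding equidistributed_01_def
proof (intro conjI allI impI)
  fix u v :: real
  assume uv: "0 \<le> u \<and> u < v \<and> v \<le> 1"
  let ?q = "\<lambda>u v M. real (card {N \<in> {1..M}. h_seq p N \<in> {u..<v}}) / real M"
  have total: "?q 0 u M + ?q u v M + ?q v 1 M = 1" if "M > 0" for M
  proof -
    let ?A = "\<lambda>u v. {N \<in> {1..M}. h_seq p N \<in> {u..<v}}"
    have "{1..M} = ?A 0 u \<union> (?A u v \<union> ?A v 1)"
    proof -
      have "h_seq p N \<in> {0..<u} \<or> h_seq p N \<in> {u..<v} \<or> h_seq p N \<in> {v..<1}" for N
        using h_seq_bounds[of p N] uv by auto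
      then show ?thesis by blast
    qed
    then have "card {1..M} = card (?A 0 u \<union> (?A u v \<union> ?A v 1))"
      by (rule arg_cong)
    also have "\<dots> = card (?A 0 u) + (card (?A u v) + card (?A v 1))"
      using uv by (auto simp: card_Un_disjoint disjoint_iff)
    finally have "real M = real (card (?A 0 u)) + (real (card (?A u v)) + real (card (?A v 1)))"
      by simp
    then show ?thesis
      using that unfolding add_divide_distrib[symmetric] by simp
  qed
  show "?q u v \<longlonglongrightarrow> v - u"
  proof (rule tendstoI)
    fix e :: real
    assume e: "e > 0"
    \<comment> \<open>The two complementary bounds, with slack \<open>e / 2\<close> each, combine to
      a lower bound for \<open>?q u v\<close> with slack \<open>e\<close>.\<close>
    have "eventually (\<lambda>M. ?q 0 u M < u - 0 + e / 2) sequentially"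
      using uv e by (intro eventually_h_seq_freq_le[OF assms]) auto
    moreover have "eventually (\<lambda>M. ?q u v M < v - u + e / 2) sequentially"
      using uv e by (intro eventually_h_seq_freq_le[OF assms]) auto
    moreover have "eventually (\<lambda>M. ?q v 1 M < 1 - v + e / 2) sequentially"
      using uv e by (intro eventually_h_seq_freq_le[OF assms]) auto
    ultimately show "eventually (\<lambda>M. dist (?q u v M) (v - u) < e) sequentially"
      using eventually_gt_at_top[of 0]
    proof eventually_elim
      case (elim M)
      with total[of M] show ?case
        unfolding dist_real_def by linarith
    qed
  qed
qed (use h_seq_bounds[of p] in auto)

text \<open>The mean value theorem turns the increment of \<open>F\<close> over a uniform partition into a
  Riemann sum of \<open>f\<close>, to which the averages of \<open>f\<close> along \<open>x\<close> are compared.\<close>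

lemma equidistributed_01_average:
  assumes "equidistributed_01 x"
    and deriv: "\<And>t. 0 \<le> t \<Longrightarrow> t \<le> 1 \<Longrightarrow> (F has_real_derivative f t) (at t)"
    and cont: "continuous_on {0..1} f"
  shows "(\<lambda>M. (1 / real M) * (\<Sum>N=1..M. f (x N))) \<longlonglongrightarrow> F 1 - F 0"
proof (rule LIMSEQ_I)
  fix e :: real
  assume e: "e > 0"
  have "uniformly_continuous_on {0..1} f"
    using cont by (simp add: compact_uniformly_continuous)
  then obtain d where d: "d > 0"
    "\<And>s t. s \<in> {0..1} \<Longrightarrow> t \<in> {0..1} \<Longrightarrow> dist s t < d \<Longrightarrow> dist (f s) (f t) < e / 2"
    using e unfolding uniformly_continuous_on_def by (metis half_gt_zero)
  \<comment> \<open>The mesh is so fine that \<open>f\<close> varies by less than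
    \<open>e / 2\<close> on each cell.\<close>
  obtain m :: nat where m: "m > 0" "1 / real m < d"
    using d(1) by (metis nat_approx_posE zero_less_Suc)
  let ?t = "\<lambda>k. real k / real m"
  have "\<exists>z. ?t k < z \<and> z < ?t (Suc k) \<and> F (?t (Suc k)) - F (?t k) = (1 / real m) * f z"
    if "k < m" for k
  proof -
    have t: "?t k < ?t (Suc k)" "0 \<le> ?t k" "?t (Suc k) \<le> 1"
      using m that by (auto simp: field_simps)
    have "\<exists>z. ?t k < z \<and> z < ?t (Suc k) \<and>
        F (?t (Suc k)) - F (?t k) = (?t (Suc k) - ?t k) * f z"
      using t by (intro MVT2 deriv) linarith+
    moreover have "?t (Suc k) - ?t k = 1 / real m"
      by (simp add: diff_divide_distrib[symmetric])
    ultimately show ?thesis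
      by (simp only:)
  qed
  then have "\<forall>k. \<exists>z. k < m \<longrightarrow>
      ?t k < z \<and> z < ?t (Suc k) \<and> F (?t (Suc k)) - F (?t k) = (1 / real m) * f z"
    by blast
  then obtain z where z: "\<And>k. k < m \<Longrightarrow> ?t k < z k" "\<And>k. k < m \<Longrightarrow> z k < ?t (Suc k)"
    "\<And>k. k < m \<Longrightarrow> F (?t (Suc k)) - F (?t k) = (1 / real m) * f (z k)"
    unfolding choice_iff by blast
  let ?q = "\<lambda>k M. real (card {N \<in> {1..M}. x N \<in> {?t k..<?t (Suc k)}}) / real M"
  \<comment> \<open>Since \<open>m\<close> is fixed, equidistribution applies cell by cell; the
    limiting Riemann sum then telescopes by the choice of \<open>z\<close>.\<close>
  have "(\<lambda>M. \<Sum>k<m. f (z k) * ?q k M) \<longlonglongrightarrow> (\<Sum>k<m. f (z k) * (?t (Suc k) - ?t k))"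
  proof (intro tendsto_sum tendsto_mult tendsto_const)
    fix k assume "k \<in> {..<m}"
    then have "0 \<le> ?t k \<and> ?t k < ?t (Suc k) \<and> ?t (Suc k) \<le> 1"
      using m by (auto simp: field_simps)
    then show "?q k \<longlonglongrightarrow> ?t (Suc k) - ?t k"
      using assms(1) unfolding equidistributed_01_def by blast
  qed
  moreover have "(\<Sum>k<m. f (z k) * (?t (Suc k) - ?t k)) = F 1 - F 0"
  proof -
    have "(\<Sum>k<m. f (z k) * (?t (Suc k) - ?t k)) = (\<Sum>k<m. F (?t (Suc k)) - F (?t k))"
      using z(3) by (intro sum.cong) (auto simp: diff_divide_distrib[symmetric])
    also have "\<dots> = F (?t m) - F (?t 0)"
      by (rule sum_lessThan_telescope)
    finally show ?thesis
      using m by simp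
  qed
  ultimately have "(\<lambda>M. \<Sum>k<m. f (z k) * ?q k M) \<longlonglongrightarrow> F 1 - F 0"
    by (simp only:)
  then obtain M0 where M0: "\<And>M. M \<ge> M0 \<Longrightarrow> \<bar>(\<Sum>k<m. f (z k) * ?q k M) - (F 1 - F 0)\<bar> < e / 2"
    using LIMSEQ_D[of _ "F 1 - F 0" "e / 2"] e unfolding real_norm_def by auto
  have near: "\<bar>(1 / real M) * (\<Sum>N=1..M. f (x N)) - (\<Sum>k<m. f (z k) * ?q k M)\<bar> \<le> e / 2"
    if M: "M > 0" for M
  proof -
    \<comment> \<open>Index of the cell containing \<open>x N\<close>; grouping the indices
      \<open>N\<close> by it compares \<open>x N\<close> with the sample point of its own
      cell.\<close>
    define \<kappa> where "\<kappa> N = nat \<lfloor>real m * x N\<rfloor>" for N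
    have x: "0 \<le> x N" "x N < 1" if "N \<in> {1..M}" for N
      using assms(1) that unfolding equidistributed_01_def by auto
    have \<kappa>: "\<kappa> N = k \<longleftrightarrow> x N \<in> {?t k..<?t (Suc k)}" if "N \<in> {1..M}" for N k
    proof -
      have "0 \<le> real m * x N" using x that by simp
      then have "\<kappa> N = k \<longleftrightarrow> real k \<le> real m * x N \<and> real m * x N < real k + 1"
        unfolding \<kappa>_def by linarith
      then show ?thesis
        using m by (auto simp: field_simps)
    qed
    have \<kappa>_less: "\<kappa> N < m" if "N \<in> {1..M}" for N
    proof -
      have "real m * x N < real m" using x that m by simp
      then show ?thesis
        unfolding \<kappa>_def using m x[OF that] by (simp add: nat_less_iff floor_less_iff)
    qed
    have "(\<Sum>k<m. f (z k) * ?q k M) = (\<Sum>k<m. \<Sum>N\<in>{N \<in> {1..M}. \<kappa> N = k}. f (z (\<kappa> N)) / real M)"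
    proof (intro sum.cong refl)
      fix k
      have "{N \<in> {1..M}. x N \<in> {?t k..<?t (Suc k)}} = {N \<in> {1..M}. \<kappa> N = k}"
        using \<kappa> by blast
      then show "f (z k) * ?q k M = (\<Sum>N\<in>{N \<in> {1..M}. \<kappa> N = k}. f (z (\<kappa> N)) / real M)"
        by simp
    qed
    also have "\<dots> = (\<Sum>N=1..M. f (z (\<kappa> N)) / real M)"
      using \<kappa>_less by (intro sum.group) auto
    finally have "(1 / real M) * (\<Sum>N=1..M. f (x N)) - (\<Sum>k<m. f (z k) * ?q k M)
        = (\<Sum>N=1..M. (f (x N) - f (z (\<kappa> N))) / real M)"
      by (simp add: sum_subtractf sum_divide_distrib diff_divide_distrib)
    also have "\<bar>\<dots>\<bar> \<le> (\<Sum>N=1..M. (e / 2) / real M)"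
    proof (rule order_trans[OF sum_abs], rule sum_mono)
      fix N assume N: "N \<in> {1..M}"
      let ?k = "\<kappa> N"
      have k: "?k < m" "?t ?k \<le> x N" "x N < ?t (Suc ?k)"
        using \<kappa>_less[OF N] \<kappa>[OF N, of ?k] by auto
      have "?t (Suc ?k) - ?t ?k = 1 / real m"
        by (simp add: diff_divide_distrib[symmetric])
      moreover have "0 \<le> ?t ?k" "?t (Suc ?k) \<le> 1"
        using k m by (auto simp: field_simps)
      ultimately have "dist (x N) (z ?k) < d" "z ?k \<in> {0..1}"
        using k(2,3) z(1,2)[OF k(1)] m(2) unfolding dist_real_def atLeastAtMost_iff by linarith+
      then have "dist (f (x N)) (f (z ?k)) < e / 2"
        using d(2) x[OF N] by simp
      then show "\<bar>(f (x N) - f (z ?k)) / real M\<bar> \<le> (e / 2) / real M"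
        unfolding dist_real_def abs_divide abs_of_nat by (intro divide_right_mono) auto
    qed
    also have "\<dots> = e / 2"
      using M by simp
    finally show ?thesis .
  qed
  show "\<exists>M0. \<forall>M\<ge>M0. norm ((1 / real M) * (\<Sum>N=1..M. f (x N)) - (F 1 - F 0)) < e"
  \<comment> \<open>The 1 keeps \<open>M\<close> positive, as \<open>near\<close> requires.\<close>
  proof (intro exI[of _ "max M0 1"] allI impI)
    fix M assume "M \<ge> max M0 1"
    then show "norm ((1 / real M) * (\<Sum>N=1..M. f (x N)) - (F 1 - F 0)) < e"
      using near[of M] M0[of M] unfolding real_norm_def by linarith
  qed
qed

subsection \<open>Averages of Bernoulli expansions\<close>

text \<open>Term-by-term antiderivative, used both for the integral and for averages along the
  sequence.\<close>

lemma has_real_derivative_bernoulli_expansion: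
  assumes "\<And>t. f t = (\<Sum>j\<le>d. g j * bernpoly j t)"
  shows "((\<lambda>t. \<Sum>j\<le>d. g j / real (Suc j) * bernpoly (Suc j) t) has_real_derivative f t)
    (at t within S)"
proof -
  have "((\<lambda>t. \<Sum>j\<le>d. g j / real (Suc j) * bernpoly (Suc j) t) has_real_derivative
      (\<Sum>j\<le>d. g j / real (Suc j) * (real (Suc j) * bernpoly j t))) (at t within S)"
    by (intro DERIV_sum DERIV_cmult has_real_derivative_bernpoly)
  then show ?thesis
    by (simp add: assms del: of_nat_Suc)
qed

text \<open>By the shift identity at 0 each increment is a multiple of \<open>0 ^ j\<close>, which
  is 1 for \<open>j = 0\<close> and 0 otherwise.\<close>

lemma bernoulli_expansion_antiderivative_diff:
  fixes g :: "nat \<Rightarrow> real"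
  shows "(\<Sum>j\<le>d. g j / real (Suc j) * bernpoly (Suc j) 1)
    - (\<Sum>j\<le>d. g j / real (Suc j) * bernpoly (Suc j) 0) = g 0"
proof -
  have "(\<Sum>j\<le>d. g j / real (Suc j) * bernpoly (Suc j) 1)
      - (\<Sum>j\<le>d. g j / real (Suc j) * bernpoly (Suc j) 0)
      = (\<Sum>j\<le>d. g j / real (Suc j) * (bernpoly (Suc j) (0 + 1) - bernpoly (Suc j) 0))"
    by (simp add: sum_subtractf right_diff_distrib)
  also have "\<dots> = (\<Sum>j\<le>d. if j = 0 then g j else 0)"
    by (intro sum.cong) (auto simp only: bernpoly_plus_1, auto)
  finally show ?thesis by simp
qed

text \<open>One period visits each point \<open>i / b\<close> once, so after exchanging the sums the
  multiplication theorem at 0 applies to each Bernoulli polynomial.\<close>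

lemma h_seq_average_rational:
  assumes "b > 0" "coprime a (int b)" "p = of_int a / real b"
    and "\<And>t. f t = (\<Sum>j\<le>d. g j * bernpoly j t)"
  shows "(1 / real b) * (\<Sum>N=1..b. f (h_seq p N)) = (\<Sum>j\<le>d. g j * (1 / real b ^ j) * bernoulli j)"
proof -
  have "(\<Sum>N=1..b. f (h_seq p N)) = (\<Sum>N\<in>{1..<1 + b}. f (h_seq p N))"
    by (intro sum.cong) auto
  also have "\<dots> = (\<Sum>y\<in>(\<lambda>i. real i / real b) ` {0..<b}. f y)"
    by (rule sum.reindex_bij_betw[OF bij_betw_h_seq[OF assms(1-3)]])
  also have "\<dots> = (\<Sum>i<b. f (real i / real b))"
    using assms(1) by (subst sum.reindex) (auto simp: inj_on_def atLeast0LessThan)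
  also have "\<dots> = (\<Sum>j\<le>d. g j * (\<Sum>i<b. bernpoly j (real i / real b)))"
    unfolding assms(4) sum_distrib_left by (rule sum.swap)
  also have "\<dots> = (\<Sum>j\<le>d. real b * (g j * (1 / real b ^ j) * bernoulli j))"
    by (simp add: bernpoly_multiplication_0[OF assms(1)] mult_ac)
  also have "\<dots> = real b * (\<Sum>j\<le>d. g j * (1 / real b ^ j) * bernoulli j)"
    by (rule sum_distrib_left[symmetric])
  finally show ?thesis
    using assms(1) by simp
qed

theorem proposition8p1:
  fixes p :: real
  assumes "0 < p" and "p < 1"
  shows
    "(p \<notin> \<rat> \<longrightarrow>
        equidistributed_01 (h_seq p) \<and>
        (\<forall>(n::nat) (r::int).
           (\<lambda>M. (1 / real M) * (\<Sum>N=1..M. c_coeff n (h_seq p N + of_int r) p))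
              \<longlonglongrightarrow> gamma_coeff n 0 r p \<and>
           ((\<lambda>h. c_coeff n (h + of_int r) p) has_integral gamma_coeff n 0 r p) {0..1}))
     \<and>
     (\<forall>(a::int) (b::nat).
        b > 0 \<and> coprime a (int b) \<and> p = of_int a / real b \<longrightarrow>
        (\<forall>N\<ge>1. h_seq p (N + b) = h_seq p N) \<and>
        (\<forall>K\<ge>1. bij_betw (h_seq p) {K..<K + b} ((\<lambda>i. real i / real b) ` {0..<b})) \<and>
        bernoulli 1 = - 1 / 2 \<and>
        (\<forall>(n::nat) (r::int).
           (\<forall>h. c_coeff n (h + of_int r) p
                  = (\<Sum>j\<le>2 * n. gamma_coeff n j r p * bernpoly j h)) \<and>
           (1 / real b) * (\<Sum>N=1..b. c_coeff n (h_seq p N + of_int r) p)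
             = (\<Sum>j\<le>2 * n. gamma_coeff n j r p * (1 / real b ^ j) * bernoulli j)))"
proof (intro conjI impI allI)
  fix n :: nat and r :: int
  \<comment> \<open>One antiderivative, whose increment over [0,1] is
    \<open>gamma_coeff n 0 r p\<close>, yields both the integral and the limit of the
    averages.\<close>
  note deriv = has_real_derivative_bernoulli_expansion[OF c_coeff_bernoulli_expansion]
  note diff = bernoulli_expansion_antiderivative_diff
  let ?f = "\<lambda>h. c_coeff n (h + of_int r) p"
  show "(?f has_integral gamma_coeff n 0 r p) {0..1}"
    using fundamental_theorem_of_calculus[of 0 1 _ ?f,
        OF _ deriv[unfolded has_real_derivative_iff_has_vector_derivative]]
    unfolding diff by simp
  obtain P where P: "\<And>t. c_coeff n t p = poly P t"
    using is_poly_deg_c_coeff unfolding is_poly_deg_def by metis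
  have "continuous_on {0..1} ?f"
    unfolding P by (intro continuous_intros)
  moreover assume "p \<notin> \<rat>"
  ultimately show "(\<lambda>M. (1 / real M) * (\<Sum>N=1..M. c_coeff n (h_seq p N + of_int r) p))
      \<longlonglongrightarrow> gamma_coeff n 0 r p"
    using equidistributed_01_average[OF equidistributed_h_seq deriv, of p n r p]
    unfolding diff by simp
next
  fix a :: int and b n :: nat and r :: int
  assume "b > 0 \<and> coprime a (int b) \<and> p = of_int a / real b"
  then have ab: "b > 0" "coprime a (int b)" "p = of_int a / real b"
    by auto
  show "h_seq p (N + b) = h_seq p N" for N
    by (rule h_seq_periodic[OF ab(1,3)])
  show "bij_betw (h_seq p) {K..<K + b} ((\<lambda>i. real i / real b) ` {0..<b})" for K
    by (rule bij_betw_h_seq[OF ab])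
  show "(1 / real b) * (\<Sum>N=1..b. c_coeff n (h_seq p N + of_int r) p)
      = (\<Sum>j\<le>2 * n. gamma_coeff n j r p * (1 / real b ^ j) * bernoulli j)"
    by (rule h_seq_average_rational[OF ab c_coeff_bernoulli_expansion])
qed (rule equidistributed_h_seq bernoulli_1 c_coeff_bernoulli_expansion, assumption?)+

end
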